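(* Let $2\le \ell\le 2d-1$. For any induced subgraph $H$ of the $d$-dimensional grid graph $P_{n_1}\square\cdots\square P_{n_d}$, if $$\deg_H(v)\in\{0,1,\dots,\ell\}\cup\{2d\}\quad\text{for all } v\in V(H),$$ then $$Z_{(\ell)}(H)=|S_\ell|,$$ where $S_\ell=\{v\in V(H):\deg_H(v)\le\ell\}$.
   Context: All graphs are finite, simple and undirected; $\deg_G(v)$ is the degree of $v$ in $G$. $P_n$ is the path on $n$ vertices, and $P_{n_1}\square\cdots\square P_{n_d}$ is the Cartesian product: its vertices are the tuples in $V(P_{n_1})\times\cdots\times V(P_{n_d})$, and two tuples are adjacent iff they differ in exactly one coordinate $k$ and their $k$-th coordinates are adjacent in $P_{n_k}$. Zero forcing color change rule: given a coloring of $V(G)$ in blue and white, a blue vertex $u$ having exactly one white neighbor $v$ may force $v$ to become blue. For an integer $\ell\ge0$, a set $B\subseteq V(G)$ is an $\ell$-leaky forcing set if for every choice of a set $L\subseteq V(G)$ of at most $\ell$ vertices (the leaks), starting with exactly the vertices of $B$ blue and repeatedly applying the color change rule, where vertices of $L$ are not allowed to perform forces, all vertices of $G$ eventually become blue. The $\ell$-leaky forcing number $Z_{(\ell)}(G)$ is the minimum cardinality of an $\ell$-leaky forcing set of $G$. *)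

theory Defs
  imports "Graph_Theory.Graph_Theory"
begin

text \<open>
  A finite simple undirected graph is a finite symmetric loop-free digraph without parallel arcs
  (\<^locale>\<open>pair_graph\<close>), so the degree of a vertex is its \<^const>\<open>out_degree\<close>.
\<close>

definition path_graph :: "nat \<Rightarrow> nat pair_pre_digraph" where
  "path_graph n = \<lparr> pverts = {..<n},
     parcs = {(i, j). i < n \<and> j < n \<and> (j = Suc i \<or> i = Suc j)} \<rparr>"

text \<open>
  Tuples are lists with one entry per factor. Since the factors are loop-free, adjacent tuples
  do differ in the coordinate \<open>k\<close>.
\<close>

definition cart_prod_verts :: "'a pair_pre_digraph list \<Rightarrow> 'a list set" where
  "cart_prod_verts Gs = {x. length x = length Gs \<and> (\<forall>k<length Gs. x ! k \<in> pverts (Gs ! k))}"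

definition cart_prod :: "'a pair_pre_digraph list \<Rightarrow> 'a list pair_pre_digraph" where
  "cart_prod Gs = \<lparr> pverts = cart_prod_verts Gs,
     parcs = {(x, y). x \<in> cart_prod_verts Gs \<and> y \<in> cart_prod_verts Gs \<and>
       (\<exists>k<length Gs. (x ! k, y ! k) \<in> parcs (Gs ! k) \<and>
         (\<forall>j<length Gs. j \<noteq> k \<longrightarrow> x ! j = y ! j))} \<rparr>"

definition grid_graph :: "nat list \<Rightarrow> nat list pair_pre_digraph" where
  "grid_graph ns = cart_prod (map path_graph ns)"

text \<open>A set \<open>B\<close> stands for the colouring in which exactly the vertices in \<open>B\<close> are blue.\<close>

inductive force_step :: "'a pair_pre_digraph \<Rightarrow> 'a set \<Rightarrow> 'a set \<Rightarrow> 'a set \<Rightarrow> bool"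
  for G :: "'a pair_pre_digraph" and L :: "'a set" where
  "\<lbrakk> u \<in> B; u \<notin> L; {w. (u, w) \<in> parcs G \<and> w \<notin> B} = {v} \<rbrakk> \<Longrightarrow> force_step G L B (insert v B)"

definition leaky_forcing_set :: "'a pair_pre_digraph \<Rightarrow> nat \<Rightarrow> 'a set \<Rightarrow> bool" where
  "leaky_forcing_set G l B \<longleftrightarrow> B \<subseteq> pverts G \<and>
     (\<forall>L. L \<subseteq> pverts G \<and> card L \<le> l \<longrightarrow> (force_step G L)\<^sup>*\<^sup>* B (pverts G))"

definition leaky_forcing_number :: "'a pair_pre_digraph \<Rightarrow> nat \<Rightarrow> nat" where
  "leaky_forcing_number G l = (LEAST k. \<exists>B. leaky_forcing_set G l B \<and> card B = k)"

lemma leaky_forcing_number_attained: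
  "\<exists>B. leaky_forcing_set G l B \<and> card B = leaky_forcing_number G l"
proof -
  have "\<exists>B. leaky_forcing_set G l B \<and> card B = card (pverts G)"
    by (rule exI[of _ "pverts G"]) (simp add: leaky_forcing_set_def)
  then show ?thesis
    unfolding leaky_forcing_number_def by (rule LeastI)
qed

lemma leaky_forcing_number_le:
  "leaky_forcing_set G l B \<Longrightarrow> leaky_forcing_number G l \<le> card B"
  unfolding leaky_forcing_number_def by (rule Least_le) blast

lemma pair_graph_path_graph: "pair_graph (path_graph n)"
proof -
  have "finite (parcs (path_graph n))"
    by (rule finite_subset[of _ "{..<n} \<times> {..<n}"]) (auto simp: path_graph_def)
  then show ?thesis
    by unfold_locales (auto simp: path_graph_def symmetric_def intro!: symI)
qed

lemma pair_graph_cart_prod: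
  assumes "\<And>G. G \<in> set Gs \<Longrightarrow> pair_graph G"
  shows "pair_graph (cart_prod Gs)"
proof -
  have fin: "finite (pverts G)" and noloop: "(u, u) \<notin> parcs G"
    and swap: "(u, v) \<in> parcs G \<Longrightarrow> (v, u) \<in> parcs G" if "G \<in> set Gs" for G u v
  proof -
    interpret pair_graph G using assms that by blast
    show "finite (pverts G)" by (rule pair_finite_verts)
    show "(u, u) \<notin> parcs G" using pair_no_loops by fastforce
    show "(u, v) \<in> parcs G \<Longrightarrow> (v, u) \<in> parcs G"
      using pair_sym_arcs by (auto simp: symmetric_def dest: symD)
  qed
  have "finite {x. set x \<subseteq> (\<Union>G\<in>set Gs. pverts G) \<and> length x = length Gs}"
    by (rule finite_lists_length_eq) (use fin in blast)
  then have finv: "finite (cart_prod_verts Gs)"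
    by (rule rev_finite_subset) (fastforce simp: cart_prod_verts_def in_set_conv_nth)
  have fina: "finite (parcs (cart_prod Gs))"
    by (rule finite_subset[OF _ finite_cartesian_product[OF finv finv]])
      (auto simp: cart_prod_def)
  have symp: "sym (parcs (cart_prod Gs))"
  proof (rule symI)
    fix x y
    assume "(x, y) \<in> parcs (cart_prod Gs)"
    then obtain k where verts: "x \<in> cart_prod_verts Gs" "y \<in> cart_prod_verts Gs"
      and k: "k < length Gs" "(x ! k, y ! k) \<in> parcs (Gs ! k)"
      and eq: "\<forall>j<length Gs. j \<noteq> k \<longrightarrow> x ! j = y ! j"
      by (auto simp: cart_prod_def)
    have "(y ! k, x ! k) \<in> parcs (Gs ! k)"
      using swap[OF nth_mem[OF k(1)] k(2)] .
    moreover have "\<forall>j<length Gs. j \<noteq> k \<longrightarrow> y ! j = x ! j"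
      using eq by simp
    ultimately show "(y, x) \<in> parcs (cart_prod Gs)"
      using verts k(1) unfolding cart_prod_def by auto
  qed
  have irrefl: "(x, x) \<notin> parcs (cart_prod Gs)" for x
    using noloop[OF nth_mem] by (auto simp: cart_prod_def)
  show ?thesis
  proof unfold_locales
    fix e assume e: "e \<in> parcs (cart_prod Gs)"
    show "fst e \<in> pverts (cart_prod Gs)" "snd e \<in> pverts (cart_prod Gs)"
      using e by (auto simp: cart_prod_def)
    show "fst e \<noteq> snd e"
      using e irrefl by (metis prod.collapse)
  next
    show "finite (pverts (cart_prod Gs))"
      using finv by (simp add: cart_prod_def)
  next
    show "finite (parcs (cart_prod Gs))" by (rule fina)
  next
    show "symmetric (with_proj (cart_prod Gs))"
      using symp by (simp add: symmetric_def)
  qed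
qed

lemma pair_graph_grid_graph: "pair_graph (grid_graph ns)"
  unfolding grid_graph_def by (rule pair_graph_cart_prod) (auto intro: pair_graph_path_graph)

end

theory Submission
  imports Defs
begin

text \<open>
  A leaky forcing set must contain every vertex of degree at most \<open>l\<close>, since otherwise all
  neighbours of that vertex could leak. Conversely, suppose that forcing from \<open>S\<^sub>l\<close> stops with a
  nonempty set \<open>W\<close> of white vertices. They have degree \<open>2 * d\<close>, so \<open>H\<close> contains all their lattice
  neighbours. For each of the \<open>2 * d\<close> directions \<open>\<plusminus>e\<^sub>k\<close>, stepping from a point of \<open>W\<close> that is
  extreme in this direction leads to a blue vertex whose only white neighbour is that point. These
  \<open>2 * d > l\<close> vertices are distinct, so one of them is not a leak and can force.
\<close>

lemma out_degree_with_proj: "out_degree (with_proj G) v = card {w. (v, w) \<in> parcs G}"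
proof -
  have "out_arcs (with_proj G) v = Pair v ` {w. (v, w) \<in> parcs G}"
    by (auto simp: out_arcs_def)
  then show ?thesis
    by (simp add: out_degree_def card_image inj_on_def)
qed

lemma low_degree_subset_leaky_forcing_set:
  assumes "pair_graph G" and B: "leaky_forcing_set G l B"
  shows "{v \<in> pverts G. out_degree (with_proj G) v \<le> l} \<subseteq> B"
proof (rule subsetI, rule ccontr)
  interpret pair_graph G by fact
  fix v
  assume v: "v \<in> {v \<in> pverts G. out_degree (with_proj G) v \<le> l}" and "v \<notin> B"
  define L where "L = {w. (v, w) \<in> parcs G}"
  have "L \<subseteq> pverts G"
    using in_arcsD2 by (auto simp: L_def)
  moreover have "card L \<le> l"
    using v by (simp add: L_def out_degree_with_proj)
  ultimately have "(force_step G L)\<^sup>*\<^sup>* B (pverts G)"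
    using B by (simp add: leaky_forcing_set_def)
  moreover have "v \<notin> C" if "(force_step G L)\<^sup>*\<^sup>* B C" for C
    using that
  proof (induction rule: rtranclp_induct)
    case (step C D)
    \<comment> \<open>Only a neighbour of \<open>v\<close> could force \<open>v\<close>, and by
      symmetry of the arcs every neighbour of \<open>v\<close> is a leak.\<close>
    have "u \<in> L" if "(u, v) \<in> parcs G" for u
      using that arcs_symmetric by (simp add: L_def)
    with step show ?case
      by (auto elim!: force_step.cases)
  qed fact
  ultimately have "v \<notin> pverts G" by blast
  then show False using v by simp
qed

text \<open>The criterion does not mention the leaks: if more than \<open>l\<close> vertices are
  able to force, at most \<open>l\<close> leaks cannot silence all of them.\<close>

lemma leaky_forcing_setI:
  assumes "pair_graph G" and "B \<subseteq> pverts G"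
    and progress: "\<And>C. B \<subseteq> C \<Longrightarrow> C \<subset> pverts G \<Longrightarrow>
      l < card {u \<in> C. \<exists>v. {w. (u, w) \<in> parcs G \<and> w \<notin> C} = {v}}"
  shows "leaky_forcing_set G l B"
  unfolding leaky_forcing_set_def
proof (intro conjI allI impI)
  interpret pair_graph G by fact
  fix L
  assume L: "L \<subseteq> pverts G \<and> card L \<le> l"
  \<comment> \<open>Generalised from \<open>B\<close> to all blue sets above it, so that the
    induction on the number of white vertices can continue after a force.\<close>
  have "(force_step G L)\<^sup>*\<^sup>* C (pverts G)" if "B \<subseteq> C" "C \<subseteq> pverts G" for C
    using that
  proof (induction "card (pverts G - C)" arbitrary: C rule: less_induct)
    case less
    show ?case
    proof (cases "C = pverts G")
      case False
      let ?U = "{u \<in> C. \<exists>v. {w. (u, w) \<in> parcs G \<and> w \<notin> C} = {v}}"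
      have "finite L" using L finite_subset pair_finite_verts by blast
      moreover have "card L < card ?U"
        using progress[OF less.prems(1)] L less.prems(2) False by fastforce
      ultimately have "\<not> ?U \<subseteq> L"
        using card_mono by (meson not_less)
      then obtain u v where u: "u \<in> C" "u \<notin> L" and v: "{w. (u, w) \<in> parcs G \<and> w \<notin> C} = {v}"
        by blast
      then have step: "force_step G L C (insert v C)"
        by (rule force_step.intros)
      have "v \<in> pverts G" "v \<notin> C"
        using v in_arcsD2 by blast+
      moreover from this have "card (pverts G - insert v C) < card (pverts G - C)"
        by (intro psubset_card_mono) auto
      ultimately have "(force_step G L)\<^sup>*\<^sup>* (insert v C) (pverts G)"
        using less.prems by (intro less.hyps) auto
      with step show ?thesis by (rule converse_rtranclp_into_rtranclp)
    qed simp
  qed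
  then show "(force_step G L)\<^sup>*\<^sup>* B (pverts G)"
    using assms(2) by blast
qed fact

lemma grid_graph_arcsE:
  assumes "(x, y) \<in> parcs (grid_graph ns)"
  obtains k where "k < length ns" "length x = length ns" "length y = length ns"
    "y ! k = Suc (x ! k) \<or> x ! k = Suc (y ! k)"
    "\<And>j. j < length ns \<Longrightarrow> j \<noteq> k \<Longrightarrow> x ! j = y ! j"
proof -
  have "length x = length ns" "length y = length ns"
    and "\<exists>k<length ns. (y ! k = Suc (x ! k) \<or> x ! k = Suc (y ! k)) \<and>
      (\<forall>j<length ns. j \<noteq> k \<longrightarrow> x ! j = y ! j)"
    using assms
    by (auto simp: grid_graph_def cart_prod_def cart_prod_verts_def path_graph_def)
  then show ?thesis using that by blast
qed

text \<open>Because of truncated subtraction, a downward step from coordinate \<open>0\<close> does not move.\<close>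

definition lattice_step :: "nat \<Rightarrow> bool \<Rightarrow> nat list \<Rightarrow> nat list" where
  "lattice_step k b x = x[k := if b then Suc (x ! k) else x ! k - 1]"

lemma grid_graph_arc_lattice_step:
  assumes "(x, y) \<in> parcs (grid_graph ns)"
  shows "\<exists>k<length ns. \<exists>b. y = lattice_step k b x"
proof -
  obtain k where k: "k < length ns" "length x = length ns" "length y = length ns"
    "y ! k = Suc (x ! k) \<or> x ! k = Suc (y ! k)"
    "\<And>j. j < length ns \<Longrightarrow> j \<noteq> k \<Longrightarrow> x ! j = y ! j"
    using assms by (rule grid_graph_arcsE) blast
  then have "y = lattice_step k (y ! k = Suc (x ! k)) x"
    by (auto simp: lattice_step_def nth_list_update intro!: nth_equalityI)
  with k(1) show ?thesis by blast
qed

text \<open>A counting argument: all neighbours of \<open>x\<close> are among its at most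
  \<open>2 * length ns\<close> lattice steps, so a vertex with that many neighbours uses every step.
  In particular no step leaves \<open>H\<close> or is truncated at \<open>0\<close>.\<close>

lemma lattice_step_arc_of_full_degree:
  assumes arcs: "parcs H \<subseteq> parcs (grid_graph ns)"
    and deg: "out_degree (with_proj H) x = 2 * length ns" and k: "k < length ns"
  shows "(x, lattice_step k b x) \<in> parcs H"
proof -
  let ?N = "{y. (x, y) \<in> parcs H}"
  let ?I = "{..<length ns} \<times> (UNIV :: bool set)"
  let ?f = "\<lambda>(k, b). lattice_step k b x"
  have "?N \<subseteq> ?f ` ?I"
    using arcs grid_graph_arc_lattice_step by fastforce
  moreover have "card (?f ` ?I) \<le> card ?N"
    using card_image_le[of ?I ?f] deg by (simp add: out_degree_with_proj card_cartesian_product)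
  ultimately have "?N = ?f ` ?I"
    by (intro card_seteq) auto
  then show ?thesis using k by force
qed

text \<open>This is the inner product with the signed unit vector \<open>+e_k\<close> or
  \<open>-e_k\<close>. Integer values let both signs be treated as maximisation.\<close>

definition coord_along :: "nat \<Rightarrow> bool \<Rightarrow> nat list \<Rightarrow> int" where
  "coord_along k b x = (if b then int (x ! k) else - int (x ! k))"

text \<open>The arc hypothesis excludes the truncated downward step: some coordinate has to change,
  and only coordinate \<open>k\<close> can.\<close>

lemma coord_along_lattice_step:
  assumes "(x, lattice_step k b x) \<in> parcs (grid_graph ns)" and "k < length ns"
  shows "coord_along k b (lattice_step k b x) = coord_along k b x + 1"
  using assms(1)
proof (rule grid_graph_arcsE)
  fix i
  assume i: "i < length ns" "length x = length ns"
    "lattice_step k b x ! i = Suc (x ! i) \<or> x ! i = Suc (lattice_step k b x ! i)"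
  then have "i = k"
    by (cases "i = k") (auto simp: lattice_step_def)
  with i show ?thesis
    by (auto simp: lattice_step_def coord_along_def)
qed

text \<open>An arc changes a single coordinate by one, so a neighbour strictly lower in a given
  direction is unique. This yields uniqueness of the white neighbour.\<close>

lemma grid_graph_arc_coord_along_less:
  assumes "(x, y) \<in> parcs (grid_graph ns)" and "k < length ns"
    and less: "coord_along k b y < coord_along k b x"
  shows "y = lattice_step k (\<not> b) x"
  using assms(1)
proof (rule grid_graph_arcsE)
  fix i
  assume i: "i < length ns" "length x = length ns" "length y = length ns"
    "y ! i = Suc (x ! i) \<or> x ! i = Suc (y ! i)"
    "\<And>j. j < length ns \<Longrightarrow> j \<noteq> i \<Longrightarrow> x ! j = y ! j"
  have "i = k"
    using less i(5)[of k] assms(2) by (cases "i = k") (auto simp: coord_along_def split: if_splits)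
  have "y = x[k := y ! k]"
    using i \<open>i = k\<close> by (intro nth_equalityI) (auto simp: nth_list_update)
  also have "\<dots> = lattice_step k (\<not> b) x"
    using i(4) \<open>i = k\<close> less by (auto simp: lattice_step_def coord_along_def split: if_splits)
  finally show ?thesis .
qed

lemma card_unique_white_neighbour_ge:
  assumes "pair_graph H" and arcs: "parcs H \<subseteq> parcs (grid_graph ns)"
    and C: "C \<subset> pverts H"
    and deg: "\<And>v. v \<in> pverts H - C \<Longrightarrow> out_degree (with_proj H) v = 2 * length ns"
  shows "2 * length ns \<le> card {u \<in> C. \<exists>v. {w. (u, w) \<in> parcs H \<and> w \<notin> C} = {v}}"
    (is "_ \<le> card ?U")
proof -
  interpret pair_graph H by fact
  let ?W = "pverts H - C"
  \<comment> \<open>The last two conditions serve to show that different directions give different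
    vertices.\<close>
  define extreme where "extreme k b u \<longleftrightarrow> u \<in> ?U \<and>
      (\<forall>w\<in>?W. coord_along k b w < coord_along k b u) \<and>
      (\<forall>j. j \<noteq> k \<longrightarrow> (\<exists>w\<in>?W. w ! j = u ! j))" for k b u
  have "\<exists>u. extreme k b u" if k: "k < length ns" for k b
  proof -
    let ?c = "coord_along k b"
    have "finite ?W" "?W \<noteq> {}" using C by auto
    then have "Max (?c ` ?W) \<in> ?c ` ?W" by simp
    then obtain w where w: "w \<in> ?W" "?c w = Max (?c ` ?W)" by force
    have max: "?c v \<le> ?c w" if "v \<in> ?W" for v
      using that w(2) \<open>finite ?W\<close> by simp
    let ?u = "lattice_step k b w"
    have uw: "(w, ?u) \<in> parcs H"
      using lattice_step_arc_of_full_degree[OF arcs deg[OF w(1)] k] .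
    then have wu: "(?u, w) \<in> parcs H" by (rule arcs_symmetric)
    have c: "?c ?u = ?c w + 1"
      using coord_along_lattice_step uw arcs k by blast
    have less: "?c v < ?c ?u" if "v \<in> ?W" for v
      using max[OF that] c by simp
    \<comment> \<open>If \<open>?u\<close> were white, it would lie strictly beyond itself.\<close>
    have "?u \<in> C" using less[of ?u] uw in_arcsD2 by blast
    moreover have "v = w" if "(?u, v) \<in> parcs H" "v \<notin> C" for v
    proof -
      \<comment> \<open>Being white, \<open>v\<close> and \<open>w\<close> both lie below
        \<open>?u\<close>, so both are the one step back from \<open>?u\<close>.\<close>
      have "v \<in> ?W" using that in_arcsD2 by blast
      with that wu w(1) show ?thesis
        using grid_graph_arc_coord_along_less[OF _ k less] arcs by (metis subsetD)
    qed
    then have "{v. (?u, v) \<in> parcs H \<and> v \<notin> C} = {w}"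
      using wu w(1) by blast
    moreover have "\<exists>v\<in>?W. v ! j = ?u ! j" if "j \<noteq> k" for j
      using w(1) that by (auto simp: lattice_step_def)
    ultimately show ?thesis using less unfolding extreme_def by blast
  qed
  then obtain g where "\<And>k b. k < length ns \<Longrightarrow> extreme k b (g k b)"
    by metis
  then have g: "\<And>k b. k < length ns \<Longrightarrow> g k b \<in> ?U"
    and above: "\<And>k b w. k < length ns \<Longrightarrow> w \<in> ?W \<Longrightarrow> coord_along k b w < coord_along k b (g k b)"
    and level: "\<And>k b j. k < length ns \<Longrightarrow> j \<noteq> k \<Longrightarrow> \<exists>w\<in>?W. w ! j = g k b ! j"
    unfolding extreme_def by blast+
  let ?I = "{..<length ns} \<times> (UNIV :: bool set)"
  have "k = k' \<and> b = b'"
    if k: "k < length ns" "k' < length ns" and eq: "g k b = g k' b'" for k b k' b'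
  proof -
    have "k = k'"
    proof (rule ccontr)
      \<comment> \<open>Extremality along \<open>k'\<close> gives a white vertex with the same
        coordinate \<open>k\<close>, but extremality along \<open>k\<close> puts the common point
        strictly beyond all white vertices in that coordinate.\<close>
      assume "k \<noteq> k'"
      then obtain w where "w \<in> ?W" "w ! k = g k b ! k"
        using level[of k' k b'] k eq by auto
      then show False using above[of k w b] k by (simp add: coord_along_def split: if_splits)
    qed
    moreover have "b = b'"
    proof -
      \<comment> \<open>With opposite signs, coordinate \<open>k\<close> of this white vertex would
        be both smaller and larger than that of the common point.\<close>
      obtain w where "w \<in> ?W" using C by blast
      then show ?thesis
        using above[of k w b] above[of k w b'] k eq \<open>k = k'\<close>
        by (auto simp: coord_along_def split: if_splits)
    qed
    ultimately show ?thesis by simp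
  qed
  then have "inj_on (\<lambda>(k, b). g k b) ?I"
    by (auto simp: inj_on_def)
  moreover have "(\<lambda>(k, b). g k b) ` ?I \<subseteq> ?U"
  proof (rule image_subsetI)
    fix p
    assume "p \<in> ?I"
    then have "g (fst p) (snd p) \<in> ?U" by (intro g) auto
    then show "(case p of (k, b) \<Rightarrow> g k b) \<in> ?U" by (simp only: case_prod_beta)
  qed
  moreover have "finite C"
    using C by (intro finite_subset[OF _ pair_finite_verts]) (rule psubset_imp_subset)
  then have "finite ?U"
    by (rule rev_finite_subset) (rule Collect_restrict)
  ultimately have "card ?I \<le> card ?U" by (rule card_inj_on_le)
  then show ?thesis by (simp add: card_cartesian_product)
qed

theorem corollary10:
  fixes d l :: nat and ns :: "nat list" and H :: "nat list pair_pre_digraph"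
  assumes "2 \<le> l" and "l \<le> 2 * d - 1"
    and "length ns = d" and "\<forall>n\<in>set ns. 1 \<le> n"
    and "induced_subgraph (with_proj H) (with_proj (grid_graph ns))"
    and "\<forall>v\<in>pverts H. out_degree (with_proj H) v \<in> {0..l} \<union> {2 * d}"
  shows "leaky_forcing_number H l = card {v \<in> pverts H. out_degree (with_proj H) v \<le> l}"
    (is "_ = card ?S")
proof -
  interpret G: pair_graph "grid_graph ns" by (rule pair_graph_grid_graph)
  have sub: "subgraph (with_proj H) (with_proj (grid_graph ns))"
    using assms(5) by (rule induced_imp_subgraph)
  then have arcs: "parcs H \<subseteq> parcs (grid_graph ns)"
    by (simp add: subgraph_def)
  have H: "pair_graph H"
  proof (rule pair_graphI_graph, rule digraph.graphI)
    show "digraph (with_proj H)" by (rule G.digraphI_induced) fact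
    show "symmetric (with_proj H)" by (rule induced_graph_imp_symmetric[OF G.pair_sym_arcs]) fact
  qed
  interpret H: pair_graph H by (rule H)
  have "leaky_forcing_set H l ?S"
  proof (rule leaky_forcing_setI[OF H])
    fix C
    assume C: "?S \<subseteq> C" "C \<subset> pverts H"
    have "out_degree (with_proj H) v = 2 * length ns" if "v \<in> pverts H - C" for v
      using assms(3,6) that C(1) by auto
    from card_unique_white_neighbour_ge[OF H arcs C(2) this]
    \<comment> \<open>Subtraction truncates in \<open>2 * d - 1\<close>; \<open>2 \<le> l\<close>
      rules out \<open>d = 0\<close>, whence \<open>l < 2 * d\<close>.\<close>
    show "l < card {u \<in> C. \<exists>v. {w. (u, w) \<in> parcs H \<and> w \<notin> C} = {v}}"
      using assms(1-3) by linarith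
  qed auto
  then have "leaky_forcing_number H l \<le> card ?S"
    by (rule leaky_forcing_number_le)
  moreover obtain B where B: "leaky_forcing_set H l B" "card B = leaky_forcing_number H l"
    using leaky_forcing_number_attained by blast
  then have "finite B"
    using finite_subset[OF _ H.pair_finite_verts] by (simp add: leaky_forcing_set_def)
  then have "card ?S \<le> leaky_forcing_number H l"
    using low_degree_subset_leaky_forcing_set[OF H B(1)] card_mono B(2) by metis
  ultimately show ?thesis by simp
qed

end
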